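(* If $P\subseteq\mathbb{R}^n$ is a polytope with $m$ vertices, then for every $k\in\mathbb{N}$, $$N\left(P,a(P)^kP\right)\le m^k.$$
   Context: A polytope in $\mathbb{R}^n$ is the convex hull of a finite non-empty set of points; $V(P)$ denotes the set of vertices of $P$; $A+B=\{a+b: a\in A,b\in B\}$ is the Minkowski sum. For a polytope $P\subset\mathbb{R}^n$ let $\lambda(P)=\sup\{\lambda\in[0,1]: P=(1-\lambda)P+\lambda V(P)\}$ and $a(P)=1-\lambda(P)$. For $K,T\subseteq\mathbb{R}^n$ the covering number is $N(K,T)=\min\{N\in\mathbb{N}:\exists x_1,\dots,x_N\in\mathbb{R}^n,\ K\subseteq\bigcup_{i=1}^N(x_i+T)\}$. *)

theory Defs
  imports "HOL-Analysis.Analysis" "HOL-Library.Set_Algebras" "HOL-Library.Extended_Nat"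
begin

(* Minkowski sums are written with the "+" on sets from Set_Algebras, and the dilate c P as
   the image of P under scaling by c. *)

definition vertices :: "'a::real_vector set \<Rightarrow> 'a set" where
  "vertices P = {v. v extreme_point_of P}"

definition lambda_of :: "'a::real_vector set \<Rightarrow> real" where
  "lambda_of P = Sup {t \<in> {0..1}. P = (*\<^sub>R) (1 - t) ` P + (*\<^sub>R) t ` vertices P}"

definition a_of :: "'a::real_vector set \<Rightarrow> real" where
  "a_of P = 1 - lambda_of P"

(* The infimum is taken in enat, so that it is a genuine minimum whenever a finite covering
   exists and infinity otherwise. *)
definition covering_number :: "'a::real_vector set \<Rightarrow> 'a set \<Rightarrow> enat" where
  "covering_number K T =
     Inf {enat N | N. \<exists>x :: nat \<Rightarrow> 'a. K \<subseteq> (\<Union>i\<in>{1..N}. (\<lambda>t. x i + t) ` T)}"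

end

theory Submission
  imports Defs
begin

text \<open>
  By compactness the supremum \<open>\<lambda>(P)\<close> is attained, so \<open>P \<subseteq> a P + \<lambda> V(P)\<close> with
  \<open>a = a(P)\<close>: the polytope is covered by \<open>m\<close> translates of \<open>a P\<close>. Covering each of these
  copies of \<open>P\<close> again in the same way, \<open>k\<close> times in total, gives \<open>m\<^sup>k\<close> translates of \<open>a\<^sup>k P\<close>.
\<close>

text \<open>Enumerating \<open>C\<close> by \<open>{1..card C}\<close> gives the indexed family in
  \<open>covering_number_def\<close>. Later arguments can thus work with finite sets of translation
  vectors.\<close>

lemma covering_number_le_card:
  assumes "finite C" and "K \<subseteq> C + T"
  shows "covering_number K T \<le> enat (card C)"
proof -
  obtain x where x: "bij_betw x {1..card C} C"
    using ex_bij_betw_nat_finite_1[OF \<open>finite C\<close>] by blast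
  have "C + T = (\<Union>c\<in>C. (\<lambda>t. c + t) ` T)"
    by (auto simp: set_plus_def)
  also have "\<dots> = (\<Union>c\<in>x ` {1..card C}. (\<lambda>t. c + t) ` T)"
    by (simp only: bij_betw_imp_surj_on[OF x])
  also have "\<dots> = (\<Union>i\<in>{1..card C}. (\<lambda>t. x i + t) ` T)"
    by (simp only: image_image)
  finally have "K \<subseteq> (\<Union>i\<in>{1..card C}. (\<lambda>t. x i + t) ` T)"
    using assms(2) by simp
  then show ?thesis
    unfolding covering_number_def by (intro Inf_lower) blast
qed

lemma iterated_cover:
  fixes P :: "'a::real_vector set"
  assumes "finite V" and cover: "P \<subseteq> (*\<^sub>R) a ` P + (*\<^sub>R) b ` V"
  shows "\<exists>C. finite C \<and> card C \<le> card V ^ k \<and> P \<subseteq> C + (*\<^sub>R) (a ^ k) ` P"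
proof (induction k)
  case 0
  show ?case
    \<comment> \<open>As \<open>a ^ 0 = 1\<close>, the single translate of \<open>P\<close> by 0
      suffices.\<close>
    by (intro exI[of _ "{0}"]) (auto simp: set_plus_def)
next
  case (Suc k)
  then obtain C where C: "finite C" "card C \<le> card V ^ k" "P \<subseteq> C + (*\<^sub>R) (a ^ k) ` P"
    by blast
  \<comment> \<open>Substituting \<open>p = a q + b v\<close> into \<open>x = c + a ^ k p\<close>
    leaves the copy \<open>a ^ Suc k\<close> of \<open>P\<close> and moves \<open>a ^ k * b\<close>
    times \<open>v\<close> into the translation. Different pairs may give the same vector, so the
    cardinality is only bounded.\<close>
  define D where "D = (\<lambda>(c, v). c + (a ^ k * b) *\<^sub>R v) ` (C \<times> V)"
  have "finite D"
    unfolding D_def using C(1) \<open>finite V\<close> by simp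
  moreover have "card D \<le> card V ^ Suc k"
  proof -
    have "card D \<le> card C * card V"
      unfolding D_def
      using card_image_le[of "C \<times> V"] C(1) \<open>finite V\<close> by (simp add: card_cartesian_product)
    also have "\<dots> \<le> card V ^ k * card V"
      using C(2) by simp
    finally show ?thesis
      by (simp add: mult.commute)
  qed
  moreover have "P \<subseteq> D + (*\<^sub>R) (a ^ Suc k) ` P"
  proof
    fix x assume "x \<in> P"
    then obtain c p where c: "c \<in> C" "p \<in> P" "x = c + a ^ k *\<^sub>R p"
      using C(3) by (auto elim!: set_plus_elim)
    obtain q v where q: "q \<in> P" "v \<in> V" "p = a *\<^sub>R q + b *\<^sub>R v"
      using cover c(2) by (auto elim!: set_plus_elim)
    have "x = (c + (a ^ k * b) *\<^sub>R v) + a ^ Suc k *\<^sub>R q"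
      by (simp add: c q algebra_simps)
    moreover have "c + (a ^ k * b) *\<^sub>R v \<in> D"
      unfolding D_def using c(1) q(2) by force
    ultimately show "x \<in> D + (*\<^sub>R) (a ^ Suc k) ` P"
      using q(1) by (blast intro: set_plus_intro)
  qed
  ultimately show ?case
    by blast
qed

lemma polytope_finite_vertices:
  fixes P :: "'a::euclidean_space set"
  assumes "polytope P"
  shows "finite (vertices P)"
  unfolding vertices_def
  using finite_polyhedron_extreme_points polytope_imp_polyhedron assms by blast

lemma polytope_vertices_nonempty:
  fixes P :: "'a::euclidean_space set"
  assumes "polytope P" and "P \<noteq> {}"
  shows "vertices P \<noteq> {}"
  unfolding vertices_def
  using extreme_point_exists_convex assms polytope_imp_compact polytope_imp_convex by blast

text \<open>The set is the projection to \<open>t\<close> of the fibre over \<open>x\<close> of a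
  continuous map on the compact set \<open>{0..1} \<times> P \<times> V\<close>.\<close>

lemma compact_mixing_parameters:
  fixes P :: "'a::euclidean_space set"
  assumes "compact P" and "compact V"
  shows "compact {t \<in> {0..1}. x \<in> (*\<^sub>R) (1 - t) ` P + (*\<^sub>R) t ` V}"
proof -
  let ?f = "\<lambda>(t, p, v). (1 - t) *\<^sub>R p + t *\<^sub>R v"
  let ?K = "({0..1} \<times> P \<times> V) \<inter> ?f -` {x}"
  have "compact ({0..1::real} \<times> P \<times> V)"
    using assms by (intro compact_Times) auto
  moreover have "continuous_on ({0..1} \<times> P \<times> V) ?f"
    unfolding case_prod_beta by (intro continuous_intros)
  ultimately have "compact ?K"
    using closedin_compact continuous_closedin_preimage closed_singleton by blast
  then have "compact (fst ` ?K)"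
    by (intro compact_continuous_image continuous_intros)
  also have "fst ` ?K = {t \<in> {0..1}. x \<in> (*\<^sub>R) (1 - t) ` P + (*\<^sub>R) t ` V}"
    by (force simp: set_plus_def)
  finally show ?thesis .
qed

text \<open>The admissible parameters form a nonempty, closed, bounded set of reals, which contains
  its supremum.\<close>

lemma polytope_lambda_attained:
  fixes P :: "'a::euclidean_space set"
  assumes "polytope P" and "P \<noteq> {}"
  shows "P \<subseteq> (*\<^sub>R) (1 - lambda_of P) ` P + (*\<^sub>R) (lambda_of P) ` vertices P"
proof -
  let ?R = "\<lambda>t. (*\<^sub>R) (1 - t) ` P + (*\<^sub>R) t ` vertices P"
  define S where "S = {t \<in> {0..1}. P = ?R t}"
  have "vertices P \<subseteq> P"
    by (auto simp: vertices_def extreme_point_of_def)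
  then have sub: "?R t \<subseteq> P" if "t \<in> {0..1}" for t
    using polytope_imp_convex[OF assms(1)] that
    by (auto simp: convex_alt elim!: set_plus_elim)
  \<comment> \<open>By \<open>sub\<close>, only \<open>P \<subseteq> ?R t\<close> remains to be
    checked, one point \<open>x\<close> at a time. This makes \<open>S\<close> an intersection of
    compact sets; since \<open>P\<close> is nonempty, the intersection stays inside
    \<open>{0..1}\<close>.\<close>
  have "S = (\<Inter>x\<in>P. {t \<in> {0..1}. x \<in> ?R t})"
    using sub assms(2) unfolding S_def by blast
  also have "closed \<dots>"
    by (intro closed_INT ballI compact_imp_closed compact_mixing_parameters
        polytope_imp_compact finite_imp_compact polytope_finite_vertices assms)
  finally have "closed S" .
  moreover have "0 \<in> S"
  proof -
    \<comment> \<open>A vertex is needed because scaling by 0 sends the empty set to itself and not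
      to \<open>{0}\<close>.\<close>
    obtain v where "v \<in> vertices P"
      using polytope_vertices_nonempty[OF assms] by blast
    then have "(*\<^sub>R) 0 ` vertices P = {0}"
      by auto
    then show ?thesis
      by (auto simp: S_def set_plus_def)
  qed
  moreover have "bdd_above S"
    by (rule bdd_aboveI[of _ 1]) (auto simp: S_def)
  ultimately have "Sup S \<in> S"
    using closed_contains_Sup by blast
  then show ?thesis
    unfolding lambda_of_def S_def by blast
qed

theorem proposition6p5:
  fixes P :: "(real ^ 'n) set" and m k :: nat
  assumes "polytope P" and "P \<noteq> {}"
    and "card (vertices P) = m"
  shows "covering_number P ((*\<^sub>R) (a_of P ^ k) ` P) \<le> enat (m ^ k)"
proof -
  \<comment> \<open>The iteration is run with \<open>a = 1 - lambda_of P\<close>, which is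
    \<open>a_of P\<close>, and \<open>b = lambda_of P\<close>.\<close>
  obtain C where C: "finite C" "card C \<le> card (vertices P) ^ k"
      "P \<subseteq> C + (*\<^sub>R) (a_of P ^ k) ` P"
    using iterated_cover[OF polytope_finite_vertices[OF assms(1)]
        polytope_lambda_attained[OF assms(1,2)]]
    unfolding a_of_def by blast
  have "covering_number P ((*\<^sub>R) (a_of P ^ k) ` P) \<le> enat (card C)"
    using C(1,3) by (rule covering_number_le_card)
  also have "\<dots> \<le> enat (m ^ k)"
    using C(2) assms(3) by simp
  finally show ?thesis .
qed

end
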